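(* Let $N,M\ge 1$, let $\mathcal{A}$ be a finite nonempty set of real $N\times M$ matrices and let $\mathcal{B}$ be a finite nonempty set of real $M\times N$ matrices. The system $$x(n)=A_nB_n\,x(n-1),\qquad n=1,2,\ldots,\quad x(n)\in\mathbb{R}^N,\ A_n\in\mathcal{A},\ B_n\in\mathcal{B},$$ is path-dependent stabilizable in the class of all perturbations $\mathcal{A}$ and controls $\mathcal{B}$ if and only if $\mu(\mathcal{A},\mathcal{B})<1$.
   Context: The system is called path-dependent stabilizable (in the class of perturbations $\mathcal{A}$ by means of controls $\mathcal{B}$) if for any sequence $\{A_n\}_{n\ge1}$ with $A_n\in\mathcal{A}$ there is a sequence $\{B_n\}_{n\ge1}$ with $B_n\in\mathcal{B}$ such that, for each initial condition $x(0)\in\mathbb{R}^N$, $x(n)=A_nB_n\cdots A_1B_1x(0)\to0$ as $n\to\infty$. The lower minimax joint spectral radius of the pair $\{\mathcal{A},\mathcal{B}\}$ is $$\mu(\mathcal{A},\mathcal{B})=\lim_{n\to\infty}\mu_n(\mathcal{A},\mathcal{B})^{1/n},\qquad \mu_n(\mathcal{A},\mathcal{B})=\max_{A_1,\ldots,A_n\in\mathcal{A}}\ \min_{B_1,\ldots,B_n\in\mathcal{B}}\|A_nB_n\cdots A_1B_1\|,$$ where $\|\cdot\|$ is a norm on the space of real $N\times N$ matrices; the limit exists and does not depend on the choice of the norm. *)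

theory Defs
  imports "HOL-Analysis.Analysis"
begin

text \<open>Nonnegativity follows from the triangle inequality for \<open>x\<close> and \<open>- x\<close>.\<close>

definition is_norm :: "('a::real_vector \<Rightarrow> real) \<Rightarrow> bool" where
  "is_norm \<nu> \<longleftrightarrow>
     (\<forall>x. \<nu> x = 0 \<longleftrightarrow> x = 0) \<and>
     (\<forall>c x. \<nu> (c *\<^sub>R x) = \<bar>c\<bar> * \<nu> x) \<and>
     (\<forall>x y. \<nu> (x + y) \<le> \<nu> x + \<nu> y)"

text \<open>The type \<open>real^'m^'n\<close> is that of matrices with \<open>CARD('n)\<close> rows and \<open>CARD('m)\<close> columns.
  Sequences are indexed from 1: their value at index 0 plays no role.\<close>

primrec path_prod ::
  "(nat \<Rightarrow> real^'m^'n) \<Rightarrow> (nat \<Rightarrow> real^'n^'m) \<Rightarrow> nat \<Rightarrow> real^'n^'n" where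
  "path_prod A B 0 = mat 1"
| "path_prod A B (Suc n) = (A (Suc n) ** B (Suc n)) ** path_prod A B n"

text \<open>The trajectories of the switching system \<open>x n = A n B n x (n - 1)\<close> are exactly the
  sequences \<open>x n = A n B n \<dots> A 1 B 1 x 0\<close>.\<close>

lemma trajectory_iff_path_prod:
  fixes A :: "nat \<Rightarrow> real^'m^'n" and B :: "nat \<Rightarrow> real^'n^'m" and x :: "nat \<Rightarrow> real^'n"
  shows "(\<forall>n\<ge>1. x n = (A n ** B n) *v x (n - 1)) \<longleftrightarrow> (\<forall>n. x n = path_prod A B n *v x 0)"
proof
  assume *: "\<forall>n\<ge>1. x n = (A n ** B n) *v x (n - 1)"
  show "\<forall>n. x n = path_prod A B n *v x 0"
  proof
    fix n show "x n = path_prod A B n *v x 0"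
    proof (induction n)
      case (Suc n)
      have "x (Suc n) = (A (Suc n) ** B (Suc n)) *v x n"
        using *[rule_format, of "Suc n"] by (simp only: diff_Suc_1 le_add1 plus_1_eq_Suc)
      also have "\<dots> = path_prod A B (Suc n) *v x 0"
        by (simp only: Suc.IH[symmetric] path_prod.simps matrix_vector_mul_assoc[symmetric])
      finally show ?case .
    qed simp
  qed
next
  assume *: "\<forall>n. x n = path_prod A B n *v x 0"
  show "\<forall>n\<ge>1. x n = (A n ** B n) *v x (n - 1)"
  proof (intro allI impI)
    fix n :: nat assume "n \<ge> 1"
    then obtain k where k: "n = Suc k" by (cases n) auto
    have "x n = path_prod A B (Suc k) *v x 0" using * k by blast
    also have "\<dots> = (A n ** B n) *v (path_prod A B k *v x 0)"
      by (simp only: k path_prod.simps matrix_vector_mul_assoc[symmetric])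
    also have "path_prod A B k *v x 0 = x (n - 1)"
      unfolding k diff_Suc_1 by (rule *[rule_format, symmetric])
    finally show "x n = (A n ** B n) *v x (n - 1)" .
  qed
qed

definition path_dependent_stabilizable ::
  "(real^'m^'n) set \<Rightarrow> (real^'n^'m) set \<Rightarrow> bool" where
  "path_dependent_stabilizable \<A> \<B> \<longleftrightarrow>
     (\<forall>A. (\<forall>n\<ge>1. A n \<in> \<A>) \<longrightarrow>
        (\<exists>B. (\<forall>n\<ge>1. B n \<in> \<B>) \<and>
             (\<forall>x0. (\<lambda>n. path_prod A B n *v x0) \<longlonglongrightarrow> 0)))"

definition minimax_norm ::
  "(real^'n^'n \<Rightarrow> real) \<Rightarrow> (real^'m^'n) set \<Rightarrow> (real^'n^'m) set \<Rightarrow> nat \<Rightarrow> real" where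
  "minimax_norm \<nu> \<A> \<B> n =
     (MAX A \<in> {1..n} \<rightarrow>\<^sub>E \<A>. MIN B \<in> {1..n} \<rightarrow>\<^sub>E \<B>. \<nu> (path_prod A B n))"

text \<open>For finite nonempty \<open>\<A>\<close> and \<open>\<B>\<close> and a norm \<open>\<nu>\<close> the limit exists and does not depend
  on \<open>\<nu>\<close>. No submultiplicativity of \<open>\<nu>\<close> is required.\<close>

definition lower_minimax_jsr ::
  "(real^'n^'n \<Rightarrow> real) \<Rightarrow> (real^'m^'n) set \<Rightarrow> (real^'n^'m) set \<Rightarrow> real" where
  "lower_minimax_jsr \<nu> \<A> \<B> = lim (\<lambda>n. root n (minimax_norm \<nu> \<A> \<B> n))"

end

theory Submission
  imports Defs
begin

text \<open>A multiple of the norm is submultiplicative, and concatenating controls makes the minimax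
  norms submultiplicative in \<open>n\<close>, so by Fekete's lemma their roots converge to the infimum, which
  is below 1 iff some minimax norm is. If it is, controls chosen block by block stabilize every
  path. Conversely, if the system is stabilizable, every path has a controlled prefix of norm at
  most 1/2; as \<open>\<A>\<close> is finite, Koenig's lemma bounds the lengths of these prefixes uniformly, and
  concatenating them makes the minimax norms decay exponentially.\<close>

section \<open>Equivalence of norms in finite dimension\<close>

lemma is_norm_nonneg:
  assumes "is_norm \<nu>"
  shows "0 \<le> \<nu> x"
proof -
  have "\<nu> (x + (-1) *\<^sub>R x) \<le> \<nu> x + \<bar>-1\<bar> * \<nu> x"
    using assms unfolding is_norm_def by metis
  moreover have "\<nu> (x + (-1) *\<^sub>R x) = 0"
    using assms unfolding is_norm_def by simp
  ultimately show ?thesis by simp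
qed

text \<open>Expand \<open>x\<close> in the orthonormal basis: each coordinate is at most
  \<open>norm x\<close> in absolute value, so the values of \<nu> on the basis yield the
  constant.\<close>

lemma is_norm_le_norm:
  fixes \<nu> :: "'a::euclidean_space \<Rightarrow> real"
  assumes "is_norm \<nu>"
  obtains C where "C > 0" "\<And>x. \<nu> x \<le> C * norm x"
proof -
  have zero: "\<nu> 0 = 0" and scale: "\<And>c x. \<nu> (c *\<^sub>R x) = \<bar>c\<bar> * \<nu> x"
    and add: "\<And>x y. \<nu> (x + y) \<le> \<nu> x + \<nu> y"
    using assms unfolding is_norm_def by auto
  have sum: "\<nu> (sum f S) \<le> (\<Sum>i\<in>S. \<nu> (f i))" for f and S :: "'a set"
  proof (induction S rule: infinite_finite_induct)
    case (insert i S)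
    then show ?case using add[of "f i" "sum f S"] by simp
  qed (use zero in auto)
  \<comment> \<open>The summand 1 makes the constant positive once the values on the basis are known
    to be nonnegative.\<close>
  have "\<nu> x \<le> (1 + (\<Sum>b\<in>Basis. \<nu> b)) * norm x" for x :: 'a
  proof -
    have "\<nu> x = \<nu> (\<Sum>b\<in>Basis. (x \<bullet> b) *\<^sub>R b)" by (simp add: euclidean_representation)
    also have "\<dots> \<le> (\<Sum>b\<in>Basis. \<bar>x \<bullet> b\<bar> * \<nu> b)" using sum[of "\<lambda>b. (x \<bullet> b) *\<^sub>R b" Basis] by (simp add: scale)
    also have "\<dots> \<le> (\<Sum>b\<in>Basis. norm x * \<nu> b)"
      by (intro sum_mono mult_right_mono Basis_le_norm is_norm_nonneg[OF assms])
    also have "\<dots> = (\<Sum>b\<in>Basis. \<nu> b) * norm x"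
      by (simp add: sum_distrib_left[symmetric] mult.commute)
    finally show ?thesis by (simp add: distrib_right add_increasing)
  qed
  moreover have "1 + (\<Sum>b\<in>(Basis::'a set). \<nu> b) > 0"
    using sum_nonneg[of "Basis::'a set" \<nu>] is_norm_nonneg[OF assms] by simp
  ultimately show ?thesis using that by blast
qed

text \<open>By the opposite bound \<nu> is Lipschitz, so it attains a minimum on the compact unit
  sphere. The minimum is positive, and homogeneity carries it to all vectors.\<close>

lemma norm_le_is_norm:
  fixes \<nu> :: "'a::euclidean_space \<Rightarrow> real"
  assumes "is_norm \<nu>"
  obtains c where "c > 0" "\<And>x. norm x \<le> c * \<nu> x"
proof -
  have zero: "\<And>x. \<nu> x = 0 \<longleftrightarrow> x = 0" and scale: "\<And>c x. \<nu> (c *\<^sub>R x) = \<bar>c\<bar> * \<nu> x"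
    and add: "\<And>x y. \<nu> (x + y) \<le> \<nu> x + \<nu> y"
    using assms unfolding is_norm_def by auto
  obtain C where C: "C > 0" "\<And>x. \<nu> x \<le> C * norm x"
    using is_norm_le_norm[OF assms] by blast
  have "C-lipschitz_on (sphere 0 1) \<nu>"
  proof (rule lipschitz_onI)
    fix x y :: 'a
    have "\<nu> x \<le> \<nu> y + \<nu> (x - y)" "\<nu> y \<le> \<nu> x + \<nu> (y - x)"
      using add[of y "x - y"] add[of x "y - x"] by simp_all
    then show "dist (\<nu> x) (\<nu> y) \<le> C * dist x y"
      using C(2)[of "x - y"] C(2)[of "y - x"]
      by (simp add: dist_real_def dist_norm norm_minus_commute)
  qed (use C in simp)
  then have cont: "continuous_on (sphere 0 1) \<nu>" by (rule lipschitz_on_continuous_on)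
  have "sphere (0::'a) 1 \<noteq> {}" by simp
  then obtain u where u: "norm u = 1" "\<And>y. norm y = 1 \<Longrightarrow> \<nu> u \<le> \<nu> y"
    using continuous_attains_inf[OF compact_sphere _ cont] by auto
  have pos: "\<nu> u > 0"
    using zero[of u] u(1) is_norm_nonneg[OF assms, of u] by (cases "u = 0") auto
  have "norm x \<le> inverse (\<nu> u) * \<nu> x" for x
  proof (cases "x = 0")
    case False
    have "\<nu> u \<le> \<nu> (inverse (norm x) *\<^sub>R x)" using False by (intro u(2)) simp
    also have "\<dots> = inverse (norm x) * \<nu> x" by (simp add: scale)
    finally show ?thesis using pos False by (simp add: field_simps)
  qed (use pos is_norm_nonneg[OF assms] in simp)
  then show ?thesis using that[of "inverse (\<nu> u)"] pos by simp
qed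

text \<open>Matrix multiplication is bilinear, hence bounded for the Euclidean norm; one comparison
  of norms for the product and one for each factor transfer this to \<nu>.\<close>

lemma is_norm_mult_bound:
  fixes \<nu> :: "real^'n^'n \<Rightarrow> real"
  assumes "is_norm \<nu>"
  obtains K where "K > 0" "\<And>X Y. \<nu> (X ** Y) \<le> K * \<nu> X * \<nu> Y"
proof -
  obtain C where C: "C > 0" "\<And>x. \<nu> x \<le> C * norm x" using is_norm_le_norm[OF assms] by blast
  obtain c where c: "c > 0" "\<And>x. norm x \<le> c * \<nu> x" using norm_le_is_norm[OF assms] by blast
  have "bilinear (\<lambda>(X :: real^'n^'n) (Y :: real^'n^'n). X ** Y)"
    unfolding bilinear_def
    by (auto intro!: linearI simp: vec_eq_iff matrix_matrix_mult_def sum_distrib_left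
        algebra_simps sum.distrib)
  then have "bounded_bilinear (\<lambda>(X :: real^'n^'n) (Y :: real^'n^'n). X ** Y)"
    by (simp add: bilinear_conv_bounded_bilinear)
  then obtain L where L: "L > 0" "\<And>(X :: real^'n^'n) (Y :: real^'n^'n). norm (X ** Y) \<le> norm X * norm Y * L"
    using bounded_bilinear.pos_bounded by blast
  have "\<nu> (X ** Y) \<le> (C * L * c * c) * \<nu> X * \<nu> Y" for X Y
  proof -
    have "\<nu> (X ** Y) \<le> C * (norm X * norm Y * L)"
      using C(1) by (intro order_trans[OF C(2)] mult_left_mono L(2)) simp
    also have "\<dots> \<le> C * (c * \<nu> X * (c * \<nu> Y) * L)"
      using C(1) L(1) c is_norm_nonneg[OF assms]
      by (intro mult_left_mono mult_right_mono mult_mono) auto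
    finally show ?thesis by (simp add: algebra_simps)
  qed
  then show ?thesis using that[of "C * L * c * c"] C(1) L(1) c(1) by simp
qed

section \<open>Fekete's lemma for roots\<close>

text \<open>For \<open>L < q < y\<close> some block length \<open>m\<close> has
  \<open>g m \<le> q ^ m\<close>. Peeling off such blocks gives \<open>g n \<le> C * q ^ n\<close>,
  and the roots of \<open>C\<close> tend to 1. Working without logarithms lets \<open>g\<close> take
  the value 0.\<close>

lemma fekete_root:
  fixes g :: "nat \<Rightarrow> real"
  assumes nonneg: "\<And>n. 0 \<le> g n" and submult: "\<And>m n. g (m + n) \<le> g m * g n"
  obtains L where "(\<lambda>n. root n (g n)) \<longlonglongrightarrow> L" "\<And>m. m \<ge> 1 \<Longrightarrow> L \<le> root m (g m)"
proof -
  define R where "R = (\<lambda>n. root n (g n)) ` {1..}"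
  define L where "L = Inf R"
  have bdd: "bdd_below R" unfolding R_def
    using nonneg by (intro bdd_belowI[of _ 0]) auto
  have ne: "R \<noteq> {}" unfolding R_def by auto
  have lower: "L \<le> root m (g m)" if "m \<ge> 1" for m
    unfolding L_def by (rule cInf_lower[OF _ bdd]) (use that in \<open>auto simp: R_def\<close>)
  have L0: "0 \<le> L" unfolding L_def using ne nonneg by (intro cInf_greatest) (auto simp: R_def)
  have "\<forall>\<^sub>F n in sequentially. root n (g n) < y" if y: "L < y" for y
  proof -
    obtain q where q: "L < q" "q < y" using dense[OF y] by blast
    then have q0: "q > 0" using L0 by simp
    obtain m where m: "m \<ge> 1" "root m (g m) < q"
      using q(1) cInf_less_iff[OF ne bdd, of q] unfolding L_def R_def by auto
    then have gm: "g m \<le> q ^ m"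
      using nonneg[of m] power_mono[of "root m (g m)" q m] by simp
    \<comment> \<open>\<open>C\<close> covers the remainders \<open>r < m\<close> that end the
      induction; the summand 1 keeps it positive, so that its roots tend to 1.\<close>
    define C where "C = 1 + (\<Sum>r<m. g r / q ^ r)"
    have C: "C > 0" unfolding C_def using nonneg q0
      by (intro add_pos_nonneg sum_nonneg) auto
    have bound: "g n \<le> C * q ^ n" for n
    proof (induction n rule: less_induct)
      case (less n)
      show ?case
      proof (cases "n < m")
        case True
        have "g n / q ^ n \<le> (\<Sum>r<m. g r / q ^ r)"
          using True nonneg q0 by (intro member_le_sum) auto
        then have "g n / q ^ n \<le> C" unfolding C_def by simp
        then show ?thesis using q0 by (simp add: field_simps)
      next
        case False
        then have "g n \<le> g m * g (n - m)" using submult[of m "n - m"] by simp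
        also have "\<dots> \<le> q ^ m * (C * q ^ (n - m))"
          using False m(1) nonneg q0 by (intro mult_mono gm less.IH) auto
        also have "\<dots> = C * q ^ n" using False by (simp flip: power_add add: mult.left_commute)
        finally show ?thesis .
      qed
    qed
    have "(\<lambda>n. root n C * q) \<longlonglongrightarrow> 1 * q"
      by (intro tendsto_mult LIMSEQ_root_const C tendsto_const)
    then have "\<forall>\<^sub>F n in sequentially. root n C * q < y"
      using q(2) by (auto intro: order_tendstoD(2))
    then show ?thesis
      using eventually_ge_at_top[of 1]
    proof eventually_elim
      case (elim n)
      have "root n (g n) \<le> root n (C * q ^ n)" using elim bound by simp
      also have "\<dots> = root n C * q" using elim q0 by (simp add: real_root_mult real_root_power_cancel)
      finally show ?case using elim by simp
    qed
  qed
  moreover have "\<forall>\<^sub>F n in sequentially. y < root n (g n)" if "y < L" for y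
    using eventually_ge_at_top[of 1] by eventually_elim (use that lower in force)
  ultimately have "(\<lambda>n. root n (g n)) \<longlonglongrightarrow> L" by (intro order_tendstoI) auto
  then show ?thesis using that lower by blast
qed

section \<open>Koenig's lemma for words over a finite alphabet\<close>

lemma koenig_finite_alphabet:
  fixes P :: "nat \<Rightarrow> (nat \<Rightarrow> 'a) \<Rightarrow> bool"
  assumes "finite S"
    and ex: "\<And>n. \<exists>A \<in> UNIV \<rightarrow> S. P n A"
    and anti: "\<And>m n A. m \<le> n \<Longrightarrow> P n A \<Longrightarrow> P m A"
    and local: "\<And>n A A'. (\<And>i. i < n \<Longrightarrow> A i = A' i) \<Longrightarrow> P n A \<Longrightarrow> P n A'"
  shows "\<exists>A \<in> UNIV \<rightarrow> S. \<forall>n. P n A"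
proof -
  \<comment> \<open>The prefix of \<open>f\<close> of length \<open>n\<close> is a node with
    arbitrarily deep descendants.\<close>
  define Q where "Q n f \<longleftrightarrow> (\<forall>m. \<exists>A \<in> UNIV \<rightarrow> S. P m A \<and> (\<forall>i<n. A i = f i))" for n f
  have step: "\<exists>g. Q (Suc n) g \<and> (\<forall>i<n. g i = f i)" if Q: "Q n f" for n f
  proof (rule ccontr)
    assume "\<not> ?thesis"
    then have "\<not> Q (Suc n) (f(n := a))" for a by auto
    then have "\<forall>a. \<exists>m. \<forall>A \<in> UNIV \<rightarrow> S. P m A \<longrightarrow> \<not> (\<forall>i<Suc n. A i = (f(n := a)) i)"
      unfolding Q_def by blast
    then obtain m where m: "\<And>a A. A \<in> UNIV \<rightarrow> S \<Longrightarrow> P (m a) A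
        \<Longrightarrow> \<not> (\<forall>i<Suc n. A i = (f(n := a)) i)"
      by metis
    \<comment> \<open>\<open>sum m S\<close> is at least \<open>m a\<close> for every letter
      \<open>a\<close> of the finite set \<open>S\<close>, so a word good to this depth contradicts
      the failure bound of its own letter at \<open>n\<close>.\<close>
    obtain A where A: "A \<in> UNIV \<rightarrow> S" "P (sum m S) A" "\<forall>i<n. A i = f i"
      using Q unfolding Q_def by blast
    have "A n \<in> S" using A(1) by auto
    then have "P (m (A n)) A" using anti[OF member_le_sum A(2)] \<open>finite S\<close> by auto
    moreover have "\<forall>i<Suc n. A i = (f(n := A n)) i" using A(3) by (auto simp: less_Suc_eq)
    ultimately show False using m A(1) by blast
  qed
  have "\<exists>f. Q 0 f" unfolding Q_def using ex by simp
  then obtain F where F: "\<And>n. Q n (F n)" "\<And>n i. i < n \<Longrightarrow> F (Suc n) i = F n i"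
    using dependent_nat_choice[of Q "\<lambda>n f g. \<forall>i<n. g i = f i"] step by metis
  \<comment> \<open>Diagonal word: the letter at \<open>i\<close> is settled from
    \<open>F (Suc i)\<close> on.\<close>
  define A where "A i = F (Suc i) i" for i
  have A: "F n i = A i" if "i < n" for n i
    using that by (induction n) (auto simp: A_def F(2) less_Suc_eq)
  have "A i \<in> S" for i
  proof -
    obtain A' where "A' \<in> UNIV \<rightarrow> S" "\<forall>j<Suc i. A' j = F (Suc i) j"
      using F(1)[of "Suc i"] unfolding Q_def by blast
    then show ?thesis unfolding A_def by (metis Pi_iff UNIV_I lessI)
  qed
  moreover have "P n A" for n
    using F(1)[of n] A local unfolding Q_def by metis
  ultimately show ?thesis by blast
qed

section \<open>Products along paths and their convergence\<close>

lemma path_prod_cong: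
  assumes "\<And>i. i \<in> {1..n} \<Longrightarrow> A i = A' i" "\<And>i. i \<in> {1..n} \<Longrightarrow> B i = B' i"
  shows "path_prod A B n = path_prod A' B' n"
  using assms by (induction n) auto

lemma path_prod_add:
  "path_prod A B (k + n) = path_prod (\<lambda>i. A (k + i)) (\<lambda>i. B (k + i)) n ** path_prod A B k"
  by (induction n) (simp_all add: matrix_mul_assoc)

text \<open>Controls for a prefix and for the shifted remainder of a path can be chosen
  independently and then joined.\<close>

lemma path_prod_append:
  "path_prod A (\<lambda>i. if i \<le> k then B i else B' (i - k)) (k + n)
     = path_prod (\<lambda>i. A (k + i)) B' n ** path_prod A B k"
  unfolding path_prod_add by (intro arg_cong2[where f = "(**)"] path_prod_cong) auto

text \<open>Evaluation at a fixed vector is linear, hence continuous; conversely the unit vectors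
  read off the columns, so every entry converges.\<close>

lemma tendsto_zero_iff_matrix_vector:
  fixes X :: "nat \<Rightarrow> real^'m^'n"
  shows "X \<longlonglongrightarrow> 0 \<longleftrightarrow> (\<forall>x. (\<lambda>n. X n *v x) \<longlonglongrightarrow> 0)"
proof (intro iffI allI)
  fix x :: "real^'m"
  assume X: "X \<longlonglongrightarrow> 0"
  have "linear (\<lambda>Y :: real^'m^'n. Y *v x)"
    by (intro linearI) (simp_all add: matrix_vector_mult_add_rdistrib scaleR_matrix_vector_assoc)
  then have "bounded_linear (\<lambda>Y :: real^'m^'n. Y *v x)" by (simp add: linear_conv_bounded_linear)
  from bounded_linear.tendsto[OF this X] show "(\<lambda>n. X n *v x) \<longlonglongrightarrow> 0" by simp
next
  assume *: "\<forall>x. (\<lambda>n. X n *v x) \<longlonglongrightarrow> 0"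
  show "X \<longlonglongrightarrow> 0"
  proof (intro vec_tendstoI)
    fix i j
    have "(\<lambda>n. (X n *v axis j 1) $ i) \<longlonglongrightarrow> (0 :: real^'n) $ i"
      using * by (intro tendsto_vec_nth) blast
    then show "(\<lambda>n. X n $ i $ j) \<longlonglongrightarrow> (0 :: real^'m^'n) $ i $ j"
      by (simp add: matrix_vector_mult_basis column_def)
  qed
qed

lemma tendsto_zero_iff_is_norm:
  fixes \<nu> :: "'a::euclidean_space \<Rightarrow> real"
  assumes "is_norm \<nu>"
  shows "X \<longlonglongrightarrow> 0 \<longleftrightarrow> (\<lambda>n. \<nu> (X n)) \<longlonglongrightarrow> 0"
proof
  obtain C where C: "\<And>x. \<nu> x \<le> C * norm x" using is_norm_le_norm[OF assms] by blast
  assume "X \<longlonglongrightarrow> 0"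
  then have "(\<lambda>n. C * norm (X n)) \<longlonglongrightarrow> 0" by (intro tendsto_mult_right_zero tendsto_norm_zero)
  then show "(\<lambda>n. \<nu> (X n)) \<longlonglongrightarrow> 0"
    by (rule tendsto_sandwich[OF _ _ tendsto_const, rotated 2])
      (auto intro!: always_eventually C is_norm_nonneg[OF assms])
next
  obtain c where c: "\<And>x. norm x \<le> c * \<nu> x" using norm_le_is_norm[OF assms] by blast
  assume "(\<lambda>n. \<nu> (X n)) \<longlonglongrightarrow> 0"
  then have "(\<lambda>n. c * \<nu> (X n)) \<longlonglongrightarrow> 0" by (intro tendsto_mult_right_zero)
  then show "X \<longlonglongrightarrow> 0"
    by (rule Lim_null_comparison[rotated]) (intro always_eventually allI c)
qed

section \<open>The minimax norms and their growth rate\<close>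

text \<open>Replaces the extrema over finite words by quantifiers over infinite sequences, which can
  be shifted and joined without tracking domains.\<close>

lemma minimax_norm_le_iff:
  fixes \<A> :: "(real^'m^'n) set" and \<B> :: "(real^'n^'m) set"
  assumes "finite \<A>" "\<A> \<noteq> {}" "finite \<B>" "\<B> \<noteq> {}"
  shows "minimax_norm \<nu> \<A> \<B> n \<le> r \<longleftrightarrow>
    (\<forall>A \<in> {1..} \<rightarrow> \<A>. \<exists>B \<in> {1..} \<rightarrow> \<B>. \<nu> (path_prod A B n) \<le> r)"
proof -
  have extend: "\<exists>F' \<in> {1..} \<rightarrow> S. \<forall>i\<in>{1..n}. F' i = F i"
    if F: "F \<in> {1..n} \<rightarrow>\<^sub>E S" and S: "S \<noteq> {}" for F :: "nat \<Rightarrow> 'x" and S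
  proof -
    obtain s where "s \<in> S" using S by blast
    \<comment> \<open>Beyond \<open>n\<close> any fixed element of \<open>S\<close> serves as
      default value.\<close>
    then show ?thesis using F by (intro bexI[of _ "\<lambda>i. if i \<le> n then F i else s"]) auto
  qed
  have fin: "finite ({1..n} \<rightarrow>\<^sub>E \<A>)" "{1..n} \<rightarrow>\<^sub>E \<A> \<noteq> {}"
    "finite ({1..n} \<rightarrow>\<^sub>E \<B>)" "{1..n} \<rightarrow>\<^sub>E \<B> \<noteq> {}"
    using assms by (auto intro!: finite_PiE simp: PiE_eq_empty_iff)
  have "minimax_norm \<nu> \<A> \<B> n \<le> r \<longleftrightarrow>
    (\<forall>A \<in> {1..n} \<rightarrow>\<^sub>E \<A>. \<exists>B \<in> {1..n} \<rightarrow>\<^sub>E \<B>. \<nu> (path_prod A B n) \<le> r)"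
    unfolding minimax_norm_def using fin by (simp add: Min_le_iff)
  also have "\<dots> \<longleftrightarrow> (\<forall>A \<in> {1..} \<rightarrow> \<A>. \<exists>B \<in> {1..} \<rightarrow> \<B>. \<nu> (path_prod A B n) \<le> r)"
  proof (intro iffI ballI)
    fix A :: "nat \<Rightarrow> real^'m^'n"
    assume *: "\<forall>A \<in> {1..n} \<rightarrow>\<^sub>E \<A>. \<exists>B \<in> {1..n} \<rightarrow>\<^sub>E \<B>. \<nu> (path_prod A B n) \<le> r"
      and "A \<in> {1..} \<rightarrow> \<A>"
    then have "restrict A {1..n} \<in> {1..n} \<rightarrow>\<^sub>E \<A>" by auto
    with * obtain B where B: "B \<in> {1..n} \<rightarrow>\<^sub>E \<B>" "\<nu> (path_prod (restrict A {1..n}) B n) \<le> r"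
      by blast
    obtain B' where B': "B' \<in> {1..} \<rightarrow> \<B>" "\<forall>i\<in>{1..n}. B' i = B i"
      using extend[OF B(1) assms(4)] by blast
    have "path_prod A B' n = path_prod (restrict A {1..n}) B n"
      using B'(2) by (intro path_prod_cong) auto
    then show "\<exists>B \<in> {1..} \<rightarrow> \<B>. \<nu> (path_prod A B n) \<le> r" using B(2) B'(1) by (intro bexI[of _ B']) simp_all
  next
    fix A assume *: "\<forall>A \<in> {1..} \<rightarrow> \<A>. \<exists>B \<in> {1..} \<rightarrow> \<B>. \<nu> (path_prod A B n) \<le> r"
      and A: "A \<in> {1..n} \<rightarrow>\<^sub>E \<A>"
    obtain A' where A': "A' \<in> {1..} \<rightarrow> \<A>" "\<forall>i\<in>{1..n}. A' i = A i"
      using extend[OF A assms(2)] by blast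
    with * obtain B where B: "B \<in> {1..} \<rightarrow> \<B>" "\<nu> (path_prod A' B n) \<le> r" by blast
    have "path_prod A (restrict B {1..n}) n = path_prod A' B n"
      using A'(2) by (intro path_prod_cong) auto
    moreover have "restrict B {1..n} \<in> {1..n} \<rightarrow>\<^sub>E \<B>" using B by auto
    ultimately show "\<exists>B \<in> {1..n} \<rightarrow>\<^sub>E \<B>. \<nu> (path_prod A B n) \<le> r"
      using B(2) by (intro bexI[of _ "restrict B {1..n}"]) simp_all
  qed
  finally show ?thesis .
qed

text \<open>\<open>K * \<nu>\<close> is a submultiplicative norm, but neither the roots in the limit nor
  convergence to 0 are affected by the factor \<open>K\<close>.\<close>

locale minimax_system =
  fixes \<A> :: "(real^'m^'n) set" and \<B> :: "(real^'n^'m) set"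
    and \<nu> :: "real^'n^'n \<Rightarrow> real" and K :: real
  assumes fin: "finite \<A>" "\<A> \<noteq> {}" "finite \<B>" "\<B> \<noteq> {}"
    and norm: "is_norm \<nu>"
    and K: "K > 0" "\<And>X Y. \<nu> (X ** Y) \<le> K * \<nu> X * \<nu> Y"
begin

definition h :: "real^'n^'n \<Rightarrow> real" where "h X = K * \<nu> X"

lemma h_nonneg: "0 \<le> h X"
  unfolding h_def using K(1) is_norm_nonneg[OF norm] by simp

lemma h_mult: "h (X ** Y) \<le> h X * h Y"
  unfolding h_def using K mult_left_mono[OF K(2)[of X Y], of K] by (simp add: algebra_simps)

lemma h_mult_le: "h X \<le> a \<Longrightarrow> h Y \<le> b \<Longrightarrow> h (X ** Y) \<le> a * b"
  using order_trans[OF h_mult mult_mono] h_nonneg order_trans by metis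

definition \<mu> :: "nat \<Rightarrow> real" where "\<mu> n = K * minimax_norm \<nu> \<A> \<B> n"

lemma \<mu>_le_iff:
  "\<mu> n \<le> r \<longleftrightarrow> (\<forall>A \<in> {1..} \<rightarrow> \<A>. \<exists>B \<in> {1..} \<rightarrow> \<B>. h (path_prod A B n) \<le> r)"
proof -
  have "\<mu> n \<le> r \<longleftrightarrow> minimax_norm \<nu> \<A> \<B> n \<le> r / K"
    unfolding \<mu>_def using K(1) by (simp add: field_simps)
  then show ?thesis
    unfolding minimax_norm_le_iff[OF fin] h_def using K(1) by (simp add: field_simps)
qed

lemma \<mu>_nonneg: "0 \<le> \<mu> n"
proof -
  have "\<exists>A. A \<in> {1..} \<rightarrow> \<A>" using fin by auto
  \<comment> \<open>With \<open>r = \<mu> n\<close>, some value of \<open>h\<close>, which is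
    nonnegative, lies below \<open>\<mu> n\<close>.\<close>
  then show ?thesis using \<mu>_le_iff[of n "\<mu> n"] h_nonneg order_trans by blast
qed

lemma \<mu>_attained:
  assumes "A \<in> {1..} \<rightarrow> \<A>"
  obtains B where "B \<in> {1..} \<rightarrow> \<B>" "h (path_prod A B n) \<le> \<mu> n"
  using \<mu>_le_iff[of n "\<mu> n"] assms by blast

text \<open>Answer the first \<open>m\<close> steps and the shifted remainder by separately optimal
  controls and join them.\<close>

lemma \<mu>_submult: "\<mu> (m + n) \<le> \<mu> m * \<mu> n"
  unfolding \<mu>_le_iff
proof
  fix A :: "nat \<Rightarrow> real^'m^'n" assume A: "A \<in> {1..} \<rightarrow> \<A>"
  then have A': "(\<lambda>i. A (m + i)) \<in> {1..} \<rightarrow> \<A>" by auto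
  obtain B where B: "B \<in> {1..} \<rightarrow> \<B>" "h (path_prod A B m) \<le> \<mu> m"
    using \<mu>_attained[OF A] by blast
  obtain B' where B': "B' \<in> {1..} \<rightarrow> \<B>" "h (path_prod (\<lambda>i. A (m + i)) B' n) \<le> \<mu> n"
    using \<mu>_attained[OF A'] by blast
  define B'' where "B'' i = (if i \<le> m then B i else B' (i - m))" for i
  have "B'' \<in> {1..} \<rightarrow> \<B>" unfolding B''_def using B B' by (auto simp: Pi_iff)
  moreover have "h (path_prod A B'' (m + n)) \<le> \<mu> m * \<mu> n"
    unfolding B''_def path_prod_append using h_mult_le[OF B'(2) B(2)] by (simp add: mult.commute)
  ultimately show "\<exists>B \<in> {1..} \<rightarrow> \<B>. h (path_prod A B (m + n)) \<le> \<mu> m * \<mu> n" by blast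
qed

text \<open>The Fekete limit lies below every root, so one value of \<mu> below 1 suffices; if there
  is none, all roots and hence the limit are at least 1.\<close>

lemma lower_minimax_jsr_less_1_iff:
  "lower_minimax_jsr \<nu> \<A> \<B> < 1 \<longleftrightarrow> (\<exists>k\<ge>1. \<mu> k < 1)"
proof -
  obtain L where L: "(\<lambda>n. root n (\<mu> n)) \<longlonglongrightarrow> L" "\<And>m. m \<ge> 1 \<Longrightarrow> L \<le> root m (\<mu> m)"
    using fekete_root[of \<mu>] \<mu>_nonneg \<mu>_submult by blast
  \<comment> \<open>The factor \<open>inverse K\<close> undoes the rescaling, and its roots tend to
    1.\<close>
  have "(\<lambda>n. root n (inverse K) * root n (\<mu> n)) \<longlonglongrightarrow> 1 * L"
    using K(1) by (intro tendsto_mult LIMSEQ_root_const L(1)) simp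
  moreover have "root n (inverse K) * root n (\<mu> n) = root n (minimax_norm \<nu> \<A> \<B> n)" for n
    unfolding real_root_mult[symmetric] \<mu>_def using K(1) by (simp flip: mult.assoc)
  ultimately have "lower_minimax_jsr \<nu> \<A> \<B> = L"
    unfolding lower_minimax_jsr_def by (intro limI) simp
  moreover have "L < 1 \<longleftrightarrow> (\<exists>k\<ge>1. \<mu> k < 1)"
  proof
    assume "L < 1"
    show "\<exists>k\<ge>1. \<mu> k < 1"
    proof (rule ccontr)
      assume *: "\<not> ?thesis"
      have "1 \<le> L"
      proof (rule tendsto_lowerbound[OF L(1)])
        show "\<forall>\<^sub>F n in sequentially. 1 \<le> root n (\<mu> n)"
          using eventually_ge_at_top[of 1] by eventually_elim (use * in force)
      qed simp
      with \<open>L < 1\<close> show False by simp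
    qed
  next
    assume "\<exists>k\<ge>1. \<mu> k < 1"
    then show "L < 1" using L(2) by (metis less_le_trans not_le real_root_lt_1_iff zero_less_one)
  qed
  ultimately show ?thesis by simp
qed

section \<open>Growth bound and stabilization by contracting blocks\<close>

text \<open>Controls the incomplete block of length below \<open>k\<close> that remains when a path
  is cut into pieces.\<close>

lemma uniform_growth_bound:
  obtains C where "C > 0" "\<And>A B n. A \<in> {1..} \<rightarrow> \<A> \<Longrightarrow> B \<in> {1..} \<rightarrow> \<B> \<Longrightarrow> n < k
    \<Longrightarrow> h (path_prod A B n) \<le> C"
proof -
  \<comment> \<open>The finite sum dominates each of its terms; the summand 1 makes the powers of
    \<open>D\<close> increase with the exponent.\<close>
  define D where "D = 1 + (\<Sum>(X, Y)\<in>\<A> \<times> \<B>. h (X ** Y))"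
  have D: "h (X ** Y) \<le> D" if "X \<in> \<A>" "Y \<in> \<B>" for X Y
    using member_le_sum[of "(X, Y)" "\<A> \<times> \<B>" "\<lambda>(X, Y). h (X ** Y)"] that fin h_nonneg
    unfolding D_def by auto
  have D1: "D \<ge> 1" unfolding D_def using h_nonneg by (auto intro!: sum_nonneg)
  have growth: "h (path_prod A B n) \<le> D ^ n * h (mat 1)"
    if "A \<in> {1..} \<rightarrow> \<A>" "B \<in> {1..} \<rightarrow> \<B>" for A B n
  proof (induction n)
    case (Suc n)
    have "h (path_prod A B (Suc n)) \<le> D * (D ^ n * h (mat 1))"
      unfolding path_prod.simps using that by (intro h_mult_le Suc.IH D) auto
    then show ?case by simp
  qed simp
  have "h (path_prod A B n) \<le> 1 + D ^ k * h (mat 1)"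
    if "A \<in> {1..} \<rightarrow> \<A>" "B \<in> {1..} \<rightarrow> \<B>" "n < k" for A B n
  proof -
    have "D ^ n * h (mat 1) \<le> D ^ k * h (mat 1)"
      using D1 that(3) h_nonneg by (intro mult_right_mono power_increasing) auto
    then show ?thesis using growth[OF that(1,2), of n] by simp
  qed
  moreover have "1 + D ^ k * h (mat 1) > 0"
    using D1 h_nonneg by (intro add_pos_nonneg mult_nonneg_nonneg) auto
  ultimately show ?thesis using that by blast
qed

text \<open>Convergence from all initial states is convergence of the matrices, which any norm
  detects.\<close>

lemma path_dependent_stabilizable_iff:
  "path_dependent_stabilizable \<A> \<B> \<longleftrightarrow>
    (\<forall>A \<in> {1..} \<rightarrow> \<A>. \<exists>B \<in> {1..} \<rightarrow> \<B>. (\<lambda>n. h (path_prod A B n)) \<longlonglongrightarrow> 0)"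
proof -
  have "(\<lambda>n. h (X n)) \<longlonglongrightarrow> 0 \<longleftrightarrow> (\<forall>x. (\<lambda>n. X n *v x) \<longlonglongrightarrow> 0)" for X
    unfolding tendsto_zero_iff_matrix_vector[symmetric] tendsto_zero_iff_is_norm[OF norm]
      h_def using K(1) by (simp add: tendsto_mult_left_iff[of K _ 0, simplified])
  then show ?thesis unfolding path_dependent_stabilizable_def by (simp add: Pi_iff Bex_def Ball_def)
qed

text \<open>Each full block of length \<open>k\<close> contributes a factor \<open>\<mu> k\<close>,
  and the incomplete last block costs only a constant.\<close>

lemma stabilizable_if_contracting:
  assumes k: "k \<ge> 1" and "\<mu> k < 1"
  shows "path_dependent_stabilizable \<A> \<B>"
  unfolding path_dependent_stabilizable_iff
proof
  fix A :: "nat \<Rightarrow> real^'m^'n" assume A: "A \<in> {1..} \<rightarrow> \<A>"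
  define q where "q = \<mu> k"
  have q: "0 \<le> q" "q < 1" unfolding q_def using \<mu>_nonneg assms by auto
  have "\<exists>B \<in> {1..} \<rightarrow> \<B>. h (path_prod (\<lambda>i. A (j * k + i)) B k) \<le> q" for j
  proof -
    have "(\<lambda>i. A (j * k + i)) \<in> {1..} \<rightarrow> \<A>" using A by auto
    then show ?thesis using \<mu>_attained unfolding q_def by metis
  qed
  then obtain F where F: "\<And>j. F j \<in> {1..} \<rightarrow> \<B>"
    "\<And>j. h (path_prod (\<lambda>i. A (j * k + i)) (F j) k) \<le> q"
    by metis
  \<comment> \<open>Times start at 1, so block \<open>j\<close> consists of the times
    \<open>j * k + 1\<close> to \<open>j * k + k\<close>; hence the shift by 1 before
    \<open>div\<close> and \<open>mod\<close> and the \<open>Suc\<close> after.\<close>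
  define B where "B i = F ((i - 1) div k) (Suc ((i - 1) mod k))" for i
  have B: "B \<in> {1..} \<rightarrow> \<B>" unfolding B_def using F(1) by force
  have "B (j * k + i) = F j i" if "i \<in> {1..k}" for i j
  proof -
    have "j * k + i - 1 = i - 1 + j * k" "i - 1 < k" using that by auto
    then have "(j * k + i - 1) div k = j" "(j * k + i - 1) mod k = i - 1" by simp_all
    then show ?thesis unfolding B_def using that by simp
  qed
  then have block: "h (path_prod (\<lambda>i. A (j * k + i)) (\<lambda>i. B (j * k + i)) k) \<le> q" for j
    using F(2)[of j] path_prod_cong[of k "\<lambda>i. A (j * k + i)" "\<lambda>i. A (j * k + i)"
        "\<lambda>i. B (j * k + i)" "F j"] by simp
  obtain C where C: "C > 0" "\<And>A B n. A \<in> {1..} \<rightarrow> \<A> \<Longrightarrow> B \<in> {1..} \<rightarrow> \<B> \<Longrightarrow> n < k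
    \<Longrightarrow> h (path_prod A B n) \<le> C"
    using uniform_growth_bound by blast
  \<comment> \<open>The starting block \<open>l\<close> is kept general because the induction peels
    off the first block and continues from \<open>Suc l\<close>.\<close>
  have decay: "h (path_prod (\<lambda>i. A (l * k + i)) (\<lambda>i. B (l * k + i)) (j * k + r)) \<le> C * q ^ j"
    if "r < k" for j l r
  proof (induction j arbitrary: l)
    case 0
    have "h (path_prod (\<lambda>i. A (l * k + i)) (\<lambda>i. B (l * k + i)) r) \<le> C"
      using A B that by (intro C(2)) auto
    then show ?case by simp
  next
    case (Suc j)
    have "h (path_prod (\<lambda>i. A (l * k + i)) (\<lambda>i. B (l * k + i)) (k + (j * k + r)))
        \<le> C * q ^ j * q"
      unfolding path_prod_add[of _ _ k]
      using Suc[of "Suc l"] by (intro h_mult_le block) (simp add: ac_simps)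
    then show ?case by (simp add: algebra_simps)
  qed
  have bound: "h (path_prod A B n) \<le> C * q ^ (n div k)" for n
    using decay[of "n mod k" 0 "n div k"] k by simp
  have "filterlim (\<lambda>n. n div k) at_top sequentially"
    using k by (intro filterlim_at_top_div_const_nat) simp
  then have "(\<lambda>n. C * q ^ (n div k)) \<longlonglongrightarrow> 0"
    using q by (intro tendsto_mult_right_zero filterlim_compose[OF LIMSEQ_realpow_zero])
  then have "(\<lambda>n. h (path_prod A B n)) \<longlonglongrightarrow> 0"
    by (rule tendsto_sandwich[OF _ _ tendsto_const, rotated 2])
      (auto intro!: always_eventually bound h_nonneg)
  with B show "\<exists>B \<in> {1..} \<rightarrow> \<B>. (\<lambda>n. h (path_prod A B n)) \<longlonglongrightarrow> 0" by blast
qed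

section \<open>Uniform contraction from stabilizability\<close>

text \<open>Compactness: if for every \<open>k\<close> some path resists all controls up to time
  \<open>k\<close>, then a single path resists forever, yet its stabilized products must drop below
  1/2.\<close>

lemma stabilizable_uniformly:
  assumes "path_dependent_stabilizable \<A> \<B>"
  obtains k where "k \<ge> 1"
    "\<And>A. A \<in> {1..} \<rightarrow> \<A> \<Longrightarrow> \<exists>i\<in>{1..k}. \<exists>B \<in> {1..} \<rightarrow> \<B>. h (path_prod A B i) \<le> 1/2"
proof (rule ccontr)
  note uniform = that
  assume "\<not> thesis"
  then have no: "\<exists>A \<in> {1..} \<rightarrow> \<A>.
      \<not> (\<exists>i\<in>{1..k}. \<exists>B \<in> {1..} \<rightarrow> \<B>. h (path_prod A B i) \<le> 1/2)"
    if "k \<ge> 1" for k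
    using uniform that by blast
  \<comment> \<open>Words in Koenig's lemma start at index 0 and paths at 1, hence the shift
    \<open>i - 1\<close>.\<close>
  define P where "P k A \<longleftrightarrow>
    (\<forall>i\<in>{1..k}. \<forall>B \<in> {1..} \<rightarrow> \<B>. \<not> h (path_prod (\<lambda>i. A (i - 1)) B i) \<le> 1/2)" for k A
  have "\<exists>A \<in> UNIV \<rightarrow> \<A>. \<forall>k. P k A"
  proof (rule koenig_finite_alphabet[OF fin(1)])
    fix k
    obtain A where A: "A \<in> {1..} \<rightarrow> \<A>"
      "\<not> (\<exists>i\<in>{1..Suc k}. \<exists>B \<in> {1..} \<rightarrow> \<B>. h (path_prod A B i) \<le> 1/2)"
      using no[of "Suc k"] by auto
    have "path_prod (\<lambda>i. A (Suc (i - 1))) B i = path_prod A B i" for B i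
      by (rule path_prod_cong) auto
    then have "P k (\<lambda>i. A (Suc i))" unfolding P_def using A(2) by fastforce
    then show "\<exists>A \<in> UNIV \<rightarrow> \<A>. P k A" using A(1) by (intro bexI[of _ "\<lambda>i. A (Suc i)"]) auto
  next
    fix m n A assume "m \<le> n" "P n A"
    then show "P m A" unfolding P_def by auto
  next
    fix n A A' assume *: "\<And>i. i < n \<Longrightarrow> A i = A' i" and "P n A"
    have "path_prod (\<lambda>i. A (i - 1)) B i = path_prod (\<lambda>i. A' (i - 1)) B i" if "i \<le> n" for B i
      using that by (intro path_prod_cong *) auto
    with \<open>P n A\<close> show "P n A'" unfolding P_def by auto
  qed
  then obtain A where A: "A \<in> UNIV \<rightarrow> \<A>" "\<And>k. P k A" by blast
  then have "(\<lambda>i. A (i - 1)) \<in> {1..} \<rightarrow> \<A>" by auto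
  then obtain B where B: "B \<in> {1..} \<rightarrow> \<B>"
    "(\<lambda>n. h (path_prod (\<lambda>i. A (i - 1)) B n)) \<longlonglongrightarrow> 0"
    using assms unfolding path_dependent_stabilizable_iff by blast
  then have "\<forall>\<^sub>F n in sequentially. h (path_prod (\<lambda>i. A (i - 1)) B n) < 1/2"
    by (intro order_tendstoD(2)) auto
  \<comment> \<open>\<open>Suc n\<close> gives a positive length, as the range of lengths in
    \<open>P\<close> demands.\<close>
  then obtain n where "h (path_prod (\<lambda>i. A (i - 1)) B (Suc n)) < 1/2"
    unfolding eventually_sequentially by (meson le_SucI order_refl)
  moreover have "\<not> h (path_prod (\<lambda>i. A (i - 1)) B (Suc n)) \<le> 1/2"
    using A(2)[of "Suc n"] B(1) unfolding P_def by fastforce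
  ultimately show False by simp
qed

text \<open>A path of length \<open>n\<close> admits at least \<open>n div k\<close> successive
  halving prefixes of length at most \<open>k\<close>, whatever the path; for large \<open>n\<close>
  this beats the constant \<open>C\<close>.\<close>

lemma contracting_if_stabilizable:
  assumes "path_dependent_stabilizable \<A> \<B>"
  shows "\<exists>k\<ge>1. \<mu> k < 1"
proof -
  obtain k where k: "k \<ge> 1"
    "\<And>A. A \<in> {1..} \<rightarrow> \<A> \<Longrightarrow> \<exists>i\<in>{1..k}. \<exists>B \<in> {1..} \<rightarrow> \<B>. h (path_prod A B i) \<le> 1/2"
    using stabilizable_uniformly[OF assms] by blast
  obtain C where C: "C > 0" "\<And>A B n. A \<in> {1..} \<rightarrow> \<A> \<Longrightarrow> B \<in> {1..} \<rightarrow> \<B> \<Longrightarrow> n < k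
    \<Longrightarrow> h (path_prod A B n) \<le> C"
    using uniform_growth_bound by blast
  \<comment> \<open>The prefix length depends on the path, so the induction is strong and ranges
    over all paths.\<close>
  have bound: "\<exists>B \<in> {1..} \<rightarrow> \<B>. h (path_prod A B n) \<le> C * (1/2) ^ (n div k)"
    if "A \<in> {1..} \<rightarrow> \<A>" for A n
    using that
  proof (induction n arbitrary: A rule: less_induct)
    case (less n)
    show ?case
    proof (cases "n < k")
      case True
      obtain B :: "nat \<Rightarrow> real^'n^'m" where B: "B \<in> {1..} \<rightarrow> \<B>" using fin(4) by fastforce
      have "h (path_prod A B n) \<le> C * (1/2) ^ (n div k)"
        using C(2)[OF less.prems B True] True by simp
      with B show ?thesis by blast
    next
      case False
      obtain i B where i: "i \<in> {1..k}" and B: "B \<in> {1..} \<rightarrow> \<B>" "h (path_prod A B i) \<le> 1/2"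
        using k(2)[OF less.prems] by blast
      have "(\<lambda>l. A (i + l)) \<in> {1..} \<rightarrow> \<A>" using less.prems by auto
      then obtain B' where B': "B' \<in> {1..} \<rightarrow> \<B>"
        "h (path_prod (\<lambda>l. A (i + l)) B' (n - i)) \<le> C * (1/2) ^ ((n - i) div k)"
        using less.IH[of "n - i" "\<lambda>l. A (i + l)"] i False by auto
      define B'' where "B'' l = (if l \<le> i then B l else B' (l - i))" for l
      \<comment> \<open>As \<open>i \<le> k\<close>, removing the prefix lowers
        \<open>n div k\<close> by at most 1, which its factor 1/2 pays for.\<close>
      have "(n - k) div k \<le> (n - i) div k" using i by (intro div_le_mono) auto
      then have "n div k \<le> Suc ((n - i) div k)" using False k(1) by (simp add: le_div_geq)
      then have dec: "(1/2 :: real) ^ Suc ((n - i) div k) \<le> (1/2) ^ (n div k)"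
        by (intro power_decreasing) auto
      have "h (path_prod A B'' (i + (n - i))) \<le> C * (1/2) ^ ((n - i) div k) * (1/2)"
        unfolding B''_def path_prod_append by (rule h_mult_le[OF B'(2) B(2)])
      also have "\<dots> \<le> C * (1/2) ^ (n div k)" using mult_left_mono[OF dec, of C] C(1) by simp
      finally have "h (path_prod A B'' n) \<le> C * (1/2) ^ (n div k)" using i False by simp
      moreover have "B'' \<in> {1..} \<rightarrow> \<B>" using B(1) B'(1) by (auto simp: B''_def Pi_iff)
      ultimately show ?thesis by blast
    qed
  qed
  obtain j where j: "(1/2 :: real) ^ j < 1 / C"
    using real_arch_pow_inv[of "1 / C" "1/2"] C(1) by auto
  \<comment> \<open>A multiple of \<open>k\<close> makes the quotient exact, and \<open>Suc\<close>
    keeps the length positive.\<close>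
  have "\<mu> (Suc j * k) \<le> C * (1/2) ^ Suc j"
    unfolding \<mu>_le_iff using bound[of _ "Suc j * k"] k(1) by auto
  also have "\<dots> < 1" using j C(1) by (simp add: field_simps)
  finally show ?thesis using k(1) by (intro exI[of _ "Suc j * k"]) auto
qed

end

theorem theorem4p3:
  fixes \<A> :: "(real^'m^'n) set"
    and \<B> :: "(real^'n^'m) set"
    and \<nu> :: "real^'n^'n \<Rightarrow> real"
  assumes "finite \<A>" and "\<A> \<noteq> {}"
    and "finite \<B>" and "\<B> \<noteq> {}"
    and "is_norm \<nu>"
  shows "path_dependent_stabilizable \<A> \<B> \<longleftrightarrow> lower_minimax_jsr \<nu> \<A> \<B> < 1"
proof -
  obtain K where "K > 0" "\<And>X Y. \<nu> (X ** Y) \<le> K * \<nu> X * \<nu> Y"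
    using is_norm_mult_bound[OF assms(5)] by blast
  with assms interpret minimax_system \<A> \<B> \<nu> K by unfold_locales
  show ?thesis
    unfolding lower_minimax_jsr_less_1_iff
    using stabilizable_if_contracting contracting_if_stabilizable by blast
qed

end
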